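(* Let $L$ be an inertia operator on $\mathrm{Imm}(S^1,\mathbb R^3)$, equivariant under the right action of $\mathrm{Diff}^+(S^1)$ and the left action of $SO(3)$, let $\Theta^L_c(h)=\int_{S^1}\langle c\times D_sc,L_ch\rangle ds$, and let $\Omega^L=-d\Theta^L$. Then for $c\in \mathrm{Imm}(S^1,\mathbb R^3)$ and $h,k\in T_c\mathrm{Imm}(S^1,\mathbb R^3)$, $$\Omega^L_c(h,k)=\int_{S^1}\Big(\langle D_s c, L_c h \times k + h\times L_c k\rangle - \langle c, D_s h \times L_c k + L_ch\times D_s k\rangle + \langle c\times D_s c, (D_{c,k}L_c)h-(D_{c,h}L_c)k\rangle\Big)\, ds .$$ Furthermore, $\Omega^L$ is invariant under the right action of $\mathrm{Diff}^+(S^1)$ and under the left action of $SO(3)$.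
   Context: $\mathrm{Imm}(S^1,\mathbb R^3)=\{c\in C^\infty(S^1,\mathbb R^3): |c_\theta|\neq 0 \text{ everywhere}\}$ is an open subset of $C^\infty(S^1,\mathbb R^3)$, with tangent spaces $T_c\mathrm{Imm}(S^1,\mathbb R^3)=C^\infty(S^1,\mathbb R^3)$; $c_\theta=\partial_\theta c$. For an immersion $c$, $D_s=\frac1{|c_\theta|}\partial_\theta$ is the arclength derivative and $ds=|c_\theta|\,d\theta$ the arclength measure; $\times$ is the cross product and $\langle\cdot,\cdot\rangle$ the Euclidean inner product on $\mathbb R^3$. $D_{c,h}$ denotes the directional derivative at $c$ in direction $h$; in particular $(D_{c,h}L_c)k$ is the derivative at $c$ in direction $h$ of $c\mapsto L_ck$ for fixed $k\in C^\infty(S^1,\mathbb R^3)$. An inertia operator is a smooth section $L\in\Gamma(\mathrm{End}(T\mathrm{Imm}(S^1,\mathbb R^3)))$, i.e. a family of linear operators $L_c:C^\infty(S^1,\mathbb R^3)\to C^\infty(S^1,\mathbb R^3)$ depending smoothly on $c$, such that each $L_c$ is an elliptic pseudodifferential operator which is self-adjoint for the $L^2(ds)$ inner product, and such that $G^L_c(h,k)=\int_{S^1}\langle L_ch,k\rangle ds$ is a weak Riemannian metric. Equivariance means $L_{c\circ\varphi}(h\circ\varphi)=(L_ch)\circ\varphi$ for $\varphi\in\mathrm{Diff}^+(S^1)$ and $L_{Oc}(Oh)=O(L_ch)$ for $O\in SO(3)$. The exterior derivative convention is $d\Theta_c(h,k)=D_{c,h}\Theta_c(k)-D_{c,k}\Theta_c(h)-\Theta_c([h,k])$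 for vector fields $h,k$ (with $[h,k]=0$ for constant vector fields). *)

theory Defs
  imports "HOL-Analysis.Analysis"
begin

section \<open>Smooth functions of a real variable\<close>

definition vderiv :: "(real \<Rightarrow> 'a::real_normed_vector) \<Rightarrow> real \<Rightarrow> 'a" where
  "vderiv f = (\<lambda>x. vector_derivative f (at x))"

definition nth_vderiv :: "nat \<Rightarrow> (real \<Rightarrow> 'a::real_normed_vector) \<Rightarrow> real \<Rightarrow> 'a" where
  "nth_vderiv n f = (vderiv ^^ n) f"

definition smooth :: "(real \<Rightarrow> 'a::real_normed_vector) \<Rightarrow> bool" where
  "smooth f \<longleftrightarrow> (\<forall>n x. nth_vderiv n f differentiable (at x))"

text \<open>An inductive form of n-fold differentiability, used only to prove closure properties of
  \<^const>\<open>smooth\<close>.\<close>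

primrec Ck :: "nat \<Rightarrow> (real \<Rightarrow> 'a::real_normed_vector) \<Rightarrow> bool" where
  "Ck 0 f = True"
| "Ck (Suc n) f = (\<exists>f'. (\<forall>x. (f has_vector_derivative f' x) (at x)) \<and> Ck n f')"

lemma nth_vderiv_0 [simp]: "nth_vderiv 0 f = f"
  by (simp add: nth_vderiv_def)

lemma nth_vderiv_Suc: "nth_vderiv (Suc n) f = nth_vderiv n (vderiv f)"
  by (simp add: nth_vderiv_def funpow_swap1)

lemma smooth_has_vderiv:
  assumes "smooth f"
  shows "(f has_vector_derivative vderiv f x) (at x)"
proof -
  have "nth_vderiv 0 f differentiable (at x)"
    using assms unfolding smooth_def by blast
  then show ?thesis
    by (simp add: vderiv_def vector_derivative_works)
qed

lemma smooth_vderiv: "smooth f \<Longrightarrow> smooth (vderiv f)"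
  unfolding smooth_def by (metis nth_vderiv_Suc)

lemma smooth_imp_Ck: "smooth f \<Longrightarrow> Ck n f"
proof (induction n arbitrary: f)
  case (Suc n)
  then show ?case
    using smooth_has_vderiv[OF Suc.prems] Suc.IH[OF smooth_vderiv[OF Suc.prems]] by auto
qed simp

lemma Ck_imp_differentiable: "Ck (Suc n) f \<Longrightarrow> nth_vderiv n f differentiable (at x)"
proof (induction n arbitrary: f)
  case 0
  then show ?case
    by (auto intro: differentiableI_vector)
next
  case (Suc n)
  then obtain f' where f': "\<And>x. (f has_vector_derivative f' x) (at x)" "Ck (Suc n) f'"
    by (metis Ck.simps(2))
  have "vderiv f = f'"
    unfolding vderiv_def using f'(1) by (auto intro: vector_derivative_at)
  then show ?case
    using Suc.IH[OF f'(2)] by (simp add: nth_vderiv_Suc)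
qed

lemma smooth_iff_Ck: "smooth f \<longleftrightarrow> (\<forall>n. Ck n f)"
  using smooth_imp_Ck Ck_imp_differentiable unfolding smooth_def by blast

lemma Ck_lower: "Ck (Suc n) f \<Longrightarrow> Ck n f"
proof (induction n arbitrary: f)
  case (Suc n)
  then show ?case by (metis Ck.simps(2))
qed simp

lemma Ck_SucI:
  "(\<And>x. (f has_vector_derivative f' x) (at x)) \<Longrightarrow> Ck n (\<lambda>x. f' x) \<Longrightarrow> Ck (Suc n) f"
  by auto

lemma Ck_add: "Ck n f \<Longrightarrow> Ck n g \<Longrightarrow> Ck n (\<lambda>x. f x + g x)"
proof (induction n arbitrary: f g)
  case (Suc n)
  obtain f' where f': "\<And>x. (f has_vector_derivative f' x) (at x)" "Ck n f'"
    using Suc.prems(1) by auto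
  obtain g' where g': "\<And>x. (g has_vector_derivative g' x) (at x)" "Ck n g'"
    using Suc.prems(2) by auto
  have "\<And>x. ((\<lambda>x. f x + g x) has_vector_derivative f' x + g' x) (at x)"
    by (intro has_vector_derivative_add f' g')
  then show ?case
    using Suc.IH[OF f'(2) g'(2)] by (rule Ck_SucI)
qed simp

lemma Ck_linear: "bounded_linear T \<Longrightarrow> Ck n f \<Longrightarrow> Ck n (\<lambda>x. T (f x))"
proof (induction n arbitrary: f)
  case (Suc n)
  obtain f' where f': "\<And>x. (f has_vector_derivative f' x) (at x)" "Ck n f'"
    using Suc.prems(2) by auto
  have "\<And>x. ((\<lambda>x. T (f x)) has_vector_derivative T (f' x)) (at x)"
    using bounded_linear.has_vector_derivative[OF Suc.prems(1) f'(1)] .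
  then show ?case
    using Suc.IH[OF Suc.prems(1) f'(2)] by (rule Ck_SucI)
qed simp

lemma Ck_scaleR:
  fixes g :: "real \<Rightarrow> real"
  shows "Ck n g \<Longrightarrow> Ck n f \<Longrightarrow> Ck n (\<lambda>x. g x *\<^sub>R f x)"
proof (induction n arbitrary: f g)
  case (Suc n)
  obtain g' where g': "\<And>x. (g has_vector_derivative g' x) (at x)" "Ck n g'"
    using Suc.prems(1) by auto
  obtain f' where f': "\<And>x. (f has_vector_derivative f' x) (at x)" "Ck n f'"
    using Suc.prems(2) by auto
  have "\<And>x. ((\<lambda>x. g x *\<^sub>R f x) has_vector_derivative (g x *\<^sub>R f' x + g' x *\<^sub>R f x)) (at x)"
    using has_vector_derivative_scaleR[OF _ f'(1)] g'(1)
    by (simp add: has_real_derivative_iff_has_vector_derivative)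
  moreover have "Ck n (\<lambda>x. g x *\<^sub>R f' x + g' x *\<^sub>R f x)"
    using Ck_add[OF Suc.IH[OF Ck_lower[OF Suc.prems(1)] f'(2)]
        Suc.IH[OF g'(2) Ck_lower[OF Suc.prems(2)]]] .
  ultimately show ?case by (rule Ck_SucI)
qed simp

lemma Ck_compose:
  fixes g :: "real \<Rightarrow> real"
  shows "Ck n g \<Longrightarrow> Ck n f \<Longrightarrow> Ck n (\<lambda>x. f (g x))"
proof (induction n arbitrary: f)
  case (Suc n)
  obtain g' where g': "\<And>x. (g has_vector_derivative g' x) (at x)" "Ck n g'"
    using Suc.prems(1) by auto
  obtain f' where f': "\<And>x. (f has_vector_derivative f' x) (at x)" "Ck n f'"
    using Suc.prems(2) by auto
  have "\<And>x. ((\<lambda>x. f (g x)) has_vector_derivative (g' x *\<^sub>R f' (g x))) (at x)"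
    using vector_diff_chain_at[OF g'(1) f'(1)] by (simp add: o_def)
  moreover have "Ck n (\<lambda>x. g' x *\<^sub>R f' (g x))"
    by (rule Ck_scaleR[OF g'(2) Suc.IH[OF Ck_lower[OF Suc.prems(1)] f'(2)]])
  ultimately show ?case by (rule Ck_SucI)
qed simp

lemma Ck_const: "Ck n (\<lambda>x. a)"
proof (induction n arbitrary: a)
  case (Suc n)
  have "\<And>x. ((\<lambda>x. a) has_vector_derivative 0) (at x)"
    by (rule has_vector_derivative_const)
  then show ?case using Suc[of 0] by (auto intro!: exI[of _ "\<lambda>x. 0"])
qed simp

lemma smooth_const: "smooth (\<lambda>x. a)"
  by (simp add: smooth_iff_Ck Ck_const)

lemma smooth_add: "smooth f \<Longrightarrow> smooth g \<Longrightarrow> smooth (\<lambda>x. f x + g x)"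
  by (simp add: smooth_iff_Ck Ck_add)

lemma smooth_linear: "bounded_linear T \<Longrightarrow> smooth f \<Longrightarrow> smooth (\<lambda>x. T (f x))"
  by (simp add: smooth_iff_Ck Ck_linear)

lemma smooth_compose:
  fixes g :: "real \<Rightarrow> real"
  shows "smooth g \<Longrightarrow> smooth f \<Longrightarrow> smooth (\<lambda>x. f (g x))"
  by (simp add: smooth_iff_Ck Ck_compose)

lemma smooth_uminus: "smooth f \<Longrightarrow> smooth (\<lambda>x. - f x)"
  by (rule smooth_linear[OF bounded_linear_minus[OF bounded_linear_ident]])

lemma smooth_diff: "smooth f \<Longrightarrow> smooth g \<Longrightarrow> smooth (\<lambda>x. f x - g x)"
  using smooth_add[OF _ smooth_uminus] by fastforce


section \<open>The Frechet space of smooth loops in 3-space\<close>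

text \<open>The circle is the quotient of the reals by translation by \<open>2 * pi\<close>; a smooth map on the circle
  is a smooth \<open>2 * pi\<close>-periodic map on the reals.\<close>

typedef loop = "{f :: real \<Rightarrow> real^3. smooth f \<and> (\<forall>\<theta>. f (\<theta> + 2 * pi) = f \<theta>)}"
  morphisms curve Loop
  by (rule exI[of _ "\<lambda>\<theta>. 0"]) (simp add: smooth_const)

setup_lifting type_definition_loop

instantiation loop :: real_vector
begin

lift_definition zero_loop :: loop is "\<lambda>\<theta>. 0"
  by (simp add: smooth_const)

lift_definition plus_loop :: "loop \<Rightarrow> loop \<Rightarrow> loop" is "\<lambda>f g \<theta>. f \<theta> + g \<theta>"
  by (simp add: smooth_add)

lift_definition minus_loop :: "loop \<Rightarrow> loop \<Rightarrow> loop" is "\<lambda>f g \<theta>. f \<theta> - g \<theta>"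
  by (simp add: smooth_diff)

lift_definition uminus_loop :: "loop \<Rightarrow> loop" is "\<lambda>f \<theta>. - f \<theta>"
  by (simp add: smooth_uminus)

lift_definition scaleR_loop :: "real \<Rightarrow> loop \<Rightarrow> loop" is "\<lambda>r f \<theta>. r *\<^sub>R f \<theta>"
  by (simp add: smooth_linear[OF bounded_linear_scaleR_right])

instance
  by standard (transfer; simp add: algebra_simps fun_eq_iff)+

end

text \<open>The topology generated by the seminorms \<open>f \<mapsto> sup \<bar>\<partial>\<^sub>\<theta>\<^sup>j f\<bar>\<close>, for all \<open>j\<close>, i.e. uniform
  convergence of all derivatives.\<close>

instantiation loop :: t2_space
begin

definition open_loop :: "loop set \<Rightarrow> bool" where
  "open_loop U \<longleftrightarrow> (\<forall>f\<in>U. \<exists>n. \<exists>e>0. \<forall>g.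
     (\<forall>j\<le>n. \<forall>\<theta>. norm (nth_vderiv j (curve (g - f)) \<theta>) < e) \<longrightarrow> g \<in> U)"

instance
proof
  show "open (UNIV :: loop set)"
    by (auto simp: open_loop_def intro: exI[of _ 1])
next
  fix S T :: "loop set"
  assume S: "open S" and T: "open T"
  show "open (S \<inter> T)"
    unfolding open_loop_def
  proof
    fix f assume f: "f \<in> S \<inter> T"
    obtain n e where 1: "e > 0"
        "\<And>g. (\<forall>j\<le>n. \<forall>\<theta>. norm (nth_vderiv j (curve (g - f)) \<theta>) < e) \<Longrightarrow> g \<in> S"
      using S f unfolding open_loop_def by (metis IntD1)
    obtain m d where 2: "d > 0"
        "\<And>g. (\<forall>j\<le>m. \<forall>\<theta>. norm (nth_vderiv j (curve (g - f)) \<theta>) < d) \<Longrightarrow> g \<in> T"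
      using T f unfolding open_loop_def by (metis IntD2)
    show "\<exists>n. \<exists>e>0. \<forall>g. (\<forall>j\<le>n. \<forall>\<theta>. norm (nth_vderiv j (curve (g - f)) \<theta>) < e) \<longrightarrow> g \<in> S \<inter> T"
      using 1 2 by (intro exI[of _ "max n m"] exI[of _ "min e d"]) auto
  qed
next
  fix K :: "loop set set"
  assume K: "\<forall>S\<in>K. open S"
  show "open (\<Union>K)"
    unfolding open_loop_def
  proof
    fix f assume "f \<in> \<Union>K"
    then obtain S where S: "S \<in> K" "f \<in> S" by blast
    then show "\<exists>n. \<exists>e>0. \<forall>g. (\<forall>j\<le>n. \<forall>\<theta>. norm (nth_vderiv j (curve (g - f)) \<theta>) < e) \<longrightarrow> g \<in> \<Union>K"
      using K unfolding open_loop_def by (meson UnionI)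
  qed
next
  fix f g :: loop
  assume "f \<noteq> g"
  then obtain t where t: "curve f t \<noteq> curve g t"
    by (metis curve_inject ext)
  define r where "r = norm (curve f t - curve g t) / 2"
  define B where "B h = {u. norm (curve u t - curve h t) < r}" for h
  have op: "open (B h)" for h
    unfolding open_loop_def
  proof
    fix u assume u: "u \<in> B h"
    define e where "e = r - norm (curve u t - curve h t)"
    have "e > 0" using u by (simp add: B_def e_def)
    moreover have "v \<in> B h" if "\<forall>j\<le>0. \<forall>\<theta>. norm (nth_vderiv j (curve (v - u)) \<theta>) < e" for v
    proof -
      have "norm (curve v t - curve u t) < e"
        using that by (simp add: minus_loop.rep_eq)
      moreover have "norm (curve v t - curve h t)
          \<le> norm (curve v t - curve u t) + norm (curve u t - curve h t)"
        using norm_triangle_ineq[of "curve v t - curve u t" "curve u t - curve h t"] by simp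
      ultimately show ?thesis by (simp add: B_def e_def)
    qed
    ultimately show "\<exists>n. \<exists>e>0. \<forall>v. (\<forall>j\<le>n. \<forall>\<theta>. norm (nth_vderiv j (curve (v - u)) \<theta>) < e) \<longrightarrow> v \<in> B h"
      by blast
  qed
  have "r > 0" using t by (simp add: r_def)
  then have "f \<in> B f" "g \<in> B g" by (simp_all add: B_def)
  moreover have "B f \<inter> B g = {}"
  proof -
    have False if "norm (curve u t - curve f t) < r" "norm (curve u t - curve g t) < r" for u
    proof -
      have "norm (curve f t - curve g t) \<le> norm (curve u t - curve f t) + norm (curve u t - curve g t)"
        using norm_triangle_ineq4[of "curve u t - curve g t" "curve u t - curve f t"] by simp
      then show False using that by (simp add: r_def)
    qed
    then show ?thesis by (auto simp: B_def)
  qed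
  ultimately show "\<exists>U V. open U \<and> open V \<and> f \<in> U \<and> g \<in> V \<and> U \<inter> V = {}"
    using op by blast
qed

end


section \<open>Differential calculus in Frechet spaces\<close>

definition dir_deriv ::
  "('a::real_vector \<Rightarrow> 'b::{real_vector,t2_space}) \<Rightarrow> 'a \<Rightarrow> 'a \<Rightarrow> 'b" where
  "dir_deriv F x h = Lim (at 0) (\<lambda>t. (1 / t) *\<^sub>R (F (x + t *\<^sub>R h) - F x))"

definition dir_differentiable ::
  "('a::real_vector \<Rightarrow> 'b::{real_vector,t2_space}) \<Rightarrow> 'a \<Rightarrow> 'a \<Rightarrow> bool" where
  "dir_differentiable F x h \<longleftrightarrow> (\<exists>l. ((\<lambda>t. (1 / t) *\<^sub>R (F (x + t *\<^sub>R h) - F x)) \<longlongrightarrow> l) (at 0))"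

primrec iter_deriv ::
  "('a::real_vector \<Rightarrow> 'b::{real_vector,t2_space}) \<Rightarrow> 'a list \<Rightarrow> 'a \<Rightarrow> 'b" where
  "iter_deriv F [] = F"
| "iter_deriv F (h # hs) = (\<lambda>x. dir_deriv (iter_deriv F hs) x h)"

text \<open>Smoothness on an open set \<open>U\<close> in the sense of Michal--Bastiani and Hamilton: all iterated
  directional derivatives exist, and the \<open>n\<close>-th one is jointly continuous in the base point and
  the \<open>n\<close> directions. Between Frechet spaces this agrees with smoothness in convenient
  calculus. The directions are the first \<open>n\<close> entries of a sequence, with the product topology
  on sequences, so that all \<open>n\<close> are covered by one type.\<close>

definition frechet_smooth_on ::
  "'a::{real_vector,topological_space} set \<Rightarrow> ('a \<Rightarrow> 'b::{real_vector,t2_space}) \<Rightarrow> bool" where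
  "frechet_smooth_on U F \<longleftrightarrow>
     (\<forall>hs. \<forall>x\<in>U. \<forall>h. dir_differentiable (iter_deriv F hs) x h) \<and>
     (\<forall>n. continuous_on (U \<times> (UNIV :: (nat \<Rightarrow> 'a) set))
            (\<lambda>(x, v). iter_deriv F (map v [0..<n]) x))"

text \<open>Vector fields are maps \<open>'a \<Rightarrow> 'a\<close> on (an open subset of) the space, and
  \<open>[X, Y] = D\<^sub>X Y - D\<^sub>Y X\<close>.\<close>

definition lie_bracket ::
  "('a::{real_vector,t2_space} \<Rightarrow> 'a) \<Rightarrow> ('a \<Rightarrow> 'a) \<Rightarrow> 'a \<Rightarrow> 'a" where
  "lie_bracket X Y c = dir_deriv Y c (X c) - dir_deriv X c (Y c)"

definition ext_deriv ::
  "('a::{real_vector,t2_space} \<Rightarrow> 'a \<Rightarrow> real) \<Rightarrow> ('a \<Rightarrow> 'a) \<Rightarrow> ('a \<Rightarrow> 'a) \<Rightarrow> 'a \<Rightarrow> real" where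
  "ext_deriv \<alpha> X Y c =
     dir_deriv (\<lambda>x. \<alpha> x (Y x)) c (X c) - dir_deriv (\<lambda>x. \<alpha> x (X x)) c (Y c)
     - \<alpha> c (lie_bracket X Y c)"


section \<open>Immersions and the two group actions\<close>

definition Imm :: "loop set" where
  "Imm = {c. \<forall>\<theta>. vderiv (curve c) \<theta> \<noteq> 0}"

definition Ds :: "loop \<Rightarrow> loop \<Rightarrow> real \<Rightarrow> real^3" where
  "Ds c h \<theta> = (1 / norm (vderiv (curve c) \<theta>)) *\<^sub>R vderiv (curve h) \<theta>"

definition int_ds :: "loop \<Rightarrow> (real \<Rightarrow> real) \<Rightarrow> real" where
  "int_ds c f = integral {0..2 * pi} (\<lambda>\<theta>. f \<theta> * norm (vderiv (curve c) \<theta>))"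

text \<open>Orientation-preserving diffeomorphisms of the circle, represented by their lifts to the
  reals. Every such diffeomorphism has a lift, and lifts that differ by a period act identically
  on loops.\<close>

definition Diff_plus :: "(real \<Rightarrow> real) set" where
  "Diff_plus = {\<phi>. smooth \<phi> \<and> (\<forall>\<theta>. \<phi> (\<theta> + 2 * pi) = \<phi> \<theta> + 2 * pi) \<and> (\<forall>\<theta>. vderiv \<phi> \<theta> > 0)}"

definition reparam :: "loop \<Rightarrow> (real \<Rightarrow> real) \<Rightarrow> loop" where
  "reparam c \<phi> = Loop (\<lambda>\<theta>. curve c (\<phi> \<theta>))"

lemma curve_reparam:
  assumes "\<phi> \<in> Diff_plus"
  shows "curve (reparam c \<phi>) \<theta> = curve c (\<phi> \<theta>)"
proof -
  have "smooth \<phi>" "\<And>\<theta>. \<phi> (\<theta> + 2 * pi) = \<phi> \<theta> + 2 * pi"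
    using assms by (auto simp: Diff_plus_def)
  then have "(\<lambda>\<theta>. curve c (\<phi> \<theta>)) \<in> {f. smooth f \<and> (\<forall>\<theta>. f (\<theta> + 2 * pi) = f \<theta>)}"
    using curve[of c] by (auto intro: smooth_compose)
  then show ?thesis
    by (simp add: reparam_def Loop_inverse)
qed

lift_definition rotate_loop :: "real^3^3 \<Rightarrow> loop \<Rightarrow> loop" is "\<lambda>A f \<theta>. A *v f \<theta>"
  by (auto intro: smooth_linear[OF matrix_vector_mul_bounded_linear])

definition Diff_equivariant :: "(loop \<Rightarrow> loop \<Rightarrow> loop) \<Rightarrow> bool" where
  "Diff_equivariant L \<longleftrightarrow>
     (\<forall>c\<in>Imm. \<forall>h. \<forall>\<phi>\<in>Diff_plus. L (reparam c \<phi>) (reparam h \<phi>) = reparam (L c h) \<phi>)"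

definition SO3_equivariant :: "(loop \<Rightarrow> loop \<Rightarrow> loop) \<Rightarrow> bool" where
  "SO3_equivariant L \<longleftrightarrow>
     (\<forall>c\<in>Imm. \<forall>h A. rotation_matrix A \<longrightarrow>
        L (rotate_loop A c) (rotate_loop A h) = rotate_loop A (L c h))"


section \<open>Elliptic pseudodifferential operators on the circle\<close>

text \<open>Pseudodifferential operators on the circle in the toroidal quantization
  \<open>(A f)(\<theta>) = \<Sum>n. exp (i n \<theta>) a(\<theta>, n) f^(n)\<close>, with matrix-valued symbols of Hoermander type
  \<open>S\<^sup>m\<close> in which the difference operator in the discrete frequency \<open>n\<close> replaces the frequency
  derivative. On the circle this yields the same operators as the definition by charts
  (Agranovich, McLean, Ruzhansky--Turunen).\<close>

definition fourier_coeff :: "loop \<Rightarrow> int \<Rightarrow> complex^3" where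
  "fourier_coeff f n = (\<chi> j. complex_of_real (1 / (2 * pi)) *
     integral {0..2 * pi} (\<lambda>\<theta>. cis (- (of_int n * \<theta>)) * complex_of_real (curve f \<theta> $ j)))"

definition freq_diff :: "(real \<Rightarrow> int \<Rightarrow> complex^3^3) \<Rightarrow> real \<Rightarrow> int \<Rightarrow> complex^3^3" where
  "freq_diff a = (\<lambda>\<theta> n. a \<theta> (n + 1) - a \<theta> n)"

definition toroidal_symbol :: "real \<Rightarrow> (real \<Rightarrow> int \<Rightarrow> complex^3^3) \<Rightarrow> bool" where
  "toroidal_symbol m a \<longleftrightarrow>
     (\<forall>n. smooth (\<lambda>\<theta>. a \<theta> n)) \<and>
     (\<forall>\<theta> n. a (\<theta> + 2 * pi) n = a \<theta> n) \<and>
     (\<forall>\<alpha> \<beta>. \<exists>C. \<forall>\<theta> n. norm (nth_vderiv \<alpha> (\<lambda>x. (freq_diff ^^ \<beta>) a x n) \<theta>)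
        \<le> C * (1 + \<bar>real_of_int n\<bar>) powr (m - real \<beta>))"

definition elliptic_symbol :: "real \<Rightarrow> (real \<Rightarrow> int \<Rightarrow> complex^3^3) \<Rightarrow> bool" where
  "elliptic_symbol m a \<longleftrightarrow>
     (\<exists>C. \<exists>N::nat. \<forall>\<theta> n. \<bar>n\<bar> \<ge> int N \<longrightarrow>
        invertible (a \<theta> n) \<and>
        norm (matrix_inv (a \<theta> n)) \<le> C * (1 + \<bar>real_of_int n\<bar>) powr (- m))"

definition psido_with_symbol ::
  "(real \<Rightarrow> int \<Rightarrow> complex^3^3) \<Rightarrow> (loop \<Rightarrow> loop) \<Rightarrow> bool" where
  "psido_with_symbol a A \<longleftrightarrow>
     (\<forall>f \<theta>. ((\<lambda>n. cis (of_int n * \<theta>) *s (a \<theta> n *v fourier_coeff f n))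
        has_sum (\<chi> j. complex_of_real (curve (A f) \<theta> $ j))) UNIV)"

definition elliptic_psido :: "(loop \<Rightarrow> loop) \<Rightarrow> bool" where
  "elliptic_psido A \<longleftrightarrow>
     (\<exists>m a. toroidal_symbol m a \<and> elliptic_symbol m a \<and> psido_with_symbol a A)"


section \<open>Inertia operators and the forms they induce\<close>

definition weak_riemannian_metric :: "(loop \<Rightarrow> loop \<Rightarrow> loop \<Rightarrow> real) \<Rightarrow> bool" where
  "weak_riemannian_metric G \<longleftrightarrow>
     frechet_smooth_on (Imm \<times> UNIV \<times> UNIV) (\<lambda>(c, h, k). G c h k) \<and>
     (\<forall>c\<in>Imm. (\<forall>k. linear (\<lambda>h. G c h k)) \<and> (\<forall>h k. G c h k = G c k h) \<and>
        (\<forall>h. h \<noteq> 0 \<longrightarrow> G c h h > 0))"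

definition metric_of :: "(loop \<Rightarrow> loop \<Rightarrow> loop) \<Rightarrow> loop \<Rightarrow> loop \<Rightarrow> loop \<Rightarrow> real" where
  "metric_of L c h k = int_ds c (\<lambda>\<theta>. curve (L c h) \<theta> \<bullet> curve k \<theta>)"

text \<open>Only the values \<open>L c\<close> at immersions \<open>c\<close> matter. A section of the endomorphism bundle is
  smooth if it is a smooth map on the total space of the trivial tangent bundle.\<close>

definition inertia_operator :: "(loop \<Rightarrow> loop \<Rightarrow> loop) \<Rightarrow> bool" where
  "inertia_operator L \<longleftrightarrow>
     (\<forall>c\<in>Imm. linear (L c)) \<and>
     frechet_smooth_on (Imm \<times> UNIV) (\<lambda>(c, h). L c h) \<and>
     (\<forall>c\<in>Imm. elliptic_psido (L c)) \<and>
     (\<forall>c\<in>Imm. \<forall>h k. int_ds c (\<lambda>\<theta>. curve (L c h) \<theta> \<bullet> curve k \<theta>) =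
                    int_ds c (\<lambda>\<theta>. curve h \<theta> \<bullet> curve (L c k) \<theta>)) \<and>
     weak_riemannian_metric (metric_of L)"

definition Theta :: "(loop \<Rightarrow> loop \<Rightarrow> loop) \<Rightarrow> loop \<Rightarrow> loop \<Rightarrow> real" where
  "Theta L c h = int_ds c (\<lambda>\<theta>. cross3 (curve c \<theta>) (Ds c c \<theta>) \<bullet> curve (L c h) \<theta>)"

text \<open>The value of \<open>- d\<Theta>\<close> on tangent vectors \<open>h\<close>, \<open>k\<close> is computed by extending them to constant
  vector fields.\<close>

definition Omega :: "(loop \<Rightarrow> loop \<Rightarrow> loop) \<Rightarrow> loop \<Rightarrow> loop \<Rightarrow> loop \<Rightarrow> real" where
  "Omega L c h k = - ext_deriv (Theta L) (\<lambda>_. h) (\<lambda>_. k) c"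

end

theory Submission
  imports Defs "HOL-Library.Periodic_Fun"
begin

text \<open>Since \<open>D\<^sub>s c ds = c\<^sub>\<theta> d\<theta>\<close>, the arclength measure cancels:
  \<open>\<Theta>\<^sub>c(h) = \<integral> \<langle>c \<times> c\<^sub>\<theta>, L\<^sub>c h\<rangle> d\<theta>\<close>, whose first factor is quadratic in \<open>c\<close>.
  Convergence of loops is uniform, so this may be differentiated under the integral sign,
  and the formula for \<open>\<Omega>\<close> is a pointwise identity between scalar triple products.
  Both groups act linearly on loops and preserve \<open>\<Theta>\<close>; since \<open>Imm\<close> is open, they preserve
  the directional derivatives of \<open>\<Theta>\<close> along constant fields, hence \<open>\<Omega>\<close>.\<close>

section \<open>Calculus of smooth loops\<close>

lemma smooth_curve: "smooth (curve c)"
  using curve[of c] by simp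

lemma curve_has_vderiv: "(curve c has_vector_derivative vderiv (curve c) \<theta>) (at \<theta>)"
  by (rule smooth_has_vderiv[OF smooth_curve])

lemma smooth_continuous_on: "smooth f \<Longrightarrow> continuous_on S f"
  by (meson continuous_at_imp_continuous_on smooth_has_vderiv has_vector_derivative_continuous)

lemma continuous_on_curve [continuous_intros]: "continuous_on S (curve c)"
  by (rule smooth_continuous_on[OF smooth_curve])

lemma continuous_on_vderiv_curve [continuous_intros]: "continuous_on S (vderiv (curve c))"
  by (rule smooth_continuous_on[OF smooth_vderiv[OF smooth_curve]])

lemma curve_periodic: "curve c (\<theta> + 2 * pi) = curve c \<theta>"
  using curve[of c] by simp

lemma vderiv_eqI: "(\<And>\<theta>. (f has_vector_derivative f' \<theta>) (at \<theta>)) \<Longrightarrow> vderiv f = f'"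
  unfolding vderiv_def by (auto intro: vector_derivative_at)

lemma vderiv_curve_periodic: "vderiv (curve c) (\<theta> + 2 * pi) = vderiv (curve c) \<theta>"
proof -
  have "((\<lambda>x. curve c (x + 2 * pi)) has_vector_derivative vderiv (curve c) (x + 2 * pi)) (at x)" for x
    using vector_diff_chain_at[of "\<lambda>x. x + 2 * pi" 1 x "curve c" "vderiv (curve c) (x + 2 * pi)"]
      curve_has_vderiv[of c "x + 2 * pi"]
    by (simp add: o_def has_vector_derivative_add_const)
  then have "vderiv (\<lambda>x. curve c (x + 2 * pi)) = (\<lambda>x. vderiv (curve c) (x + 2 * pi))"
    by (rule vderiv_eqI)
  from fun_cong[OF this] show ?thesis
    unfolding curve_periodic by simp
qed

lemma curve_add: "curve (c + h) \<theta> = curve c \<theta> + curve h \<theta>"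
  by (simp add: plus_loop.rep_eq)

lemma curve_scaleR: "curve (t *\<^sub>R h) \<theta> = t *\<^sub>R curve h \<theta>"
  by (simp add: scaleR_loop.rep_eq)

lemma curve_diff: "curve (c - h) \<theta> = curve c \<theta> - curve h \<theta>"
  by (simp add: minus_loop.rep_eq)

lemma curve_zero: "curve 0 \<theta> = 0"
  by (simp add: zero_loop.rep_eq)

lemma vderiv_curve_line:
  "vderiv (curve (c + t *\<^sub>R h)) \<theta> = vderiv (curve c) \<theta> + t *\<^sub>R vderiv (curve h) \<theta>"
proof -
  have "curve (c + t *\<^sub>R h) = (\<lambda>\<theta>. curve c \<theta> + t *\<^sub>R curve h \<theta>)"
    by (simp add: fun_eq_iff curve_add curve_scaleR)
  moreover have "((\<lambda>\<theta>. curve c \<theta> + t *\<^sub>R curve h \<theta>) has_vector_derivative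
      vderiv (curve c) x + t *\<^sub>R vderiv (curve h) x) (at x)" for x
    by (intro has_vector_derivative_add curve_has_vderiv
        bounded_linear.has_vector_derivative[OF bounded_linear_scaleR_right])
  then have "vderiv (\<lambda>\<theta>. curve c \<theta> + t *\<^sub>R curve h \<theta>)
      = (\<lambda>\<theta>. vderiv (curve c) \<theta> + t *\<^sub>R vderiv (curve h) \<theta>)"
    by (rule vderiv_eqI)
  ultimately show ?thesis
    by simp
qed

section \<open>Periodic functions and their integrals\<close>

lemma periodic_representative:
  fixes f :: "real \<Rightarrow> 'a" and p :: real
  assumes "p > 0" and "\<And>x. f (x + p) = f x"
  obtains n :: int where "x - n * p \<in> {0..p}" "\<And>y. f (y + n * p) = f y"
proof
  interpret periodic_fun_simple f p by standard (rule assms)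
  have "frac (x / p) \<in> {0..1}"
    by (simp add: frac_lt_1 less_imp_le)
  \<comment> \<open>The witness is \<open>n = \<lfloor>x / p\<rfloor>\<close>, so the remainder is
    \<open>p\<close> times a fractional part.\<close>
  moreover have "x - \<lfloor>x / p\<rfloor> * p = p * frac (x / p)"
    using assms(1) by (simp add: frac_def field_simps)
  ultimately show "x - \<lfloor>x / p\<rfloor> * p \<in> {0..p}"
    using assms(1) mult_left_le[of "frac (x / p)" p] by auto
  show "f (y + \<lfloor>x / p\<rfloor> * p) = f y" for y
    by (rule plus_of_int)
qed

text \<open>Carries extrema found on the compact interval \<open>{0..p}\<close> over to the whole
  line.\<close>

lemma periodic_value_attained:
  fixes f :: "real \<Rightarrow> 'a" and p :: real
  assumes "p > 0" and "\<And>x. f (x + p) = f x"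
  obtains y where "y \<in> {0..p}" "f x = f y"
proof -
  obtain n :: int where n: "x - n * p \<in> {0..p}" "\<And>y. f (y + n * p) = f y"
    using periodic_representative[of p f, OF assms] by blast
  have "f x = f (x - n * p)"
    using n(2)[of "x - n * p"] by simp
  then show thesis using n(1) that by blast
qed

text \<open>Shifting the window by whole periods puts its left end \<open>r\<close> into
  \<open>{0..p}\<close>; the piece beyond \<open>p\<close> then moves back by one period and becomes
  \<open>{0..r}\<close>.\<close>

lemma integral_periodic:
  fixes f :: "real \<Rightarrow> 'a::euclidean_space" and p :: real
  assumes "p > 0" and per: "\<And>x. f (x + p) = f x" and cont: "continuous_on UNIV f"
  shows "integral {a..a + p} f = integral {0..p} f"
proof -
  have cont': "continuous_on S f" for S
    using cont continuous_on_subset by blast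
  have int: "f integrable_on {u..v}" for u v
    by (intro integrable_continuous_interval cont')
  obtain n :: int where n: "a - n * p \<in> {0..p}" "\<And>y. f (y + n * p) = f y"
    using periodic_representative[of p f, OF assms(1,2)] by blast
  define r where "r = a - n * p"
  have "integral {a..a + p} f = integral {r..r + p} (\<lambda>x. f (x + n * p))"
    using Henstock_Kurzweil_Integration.integral_shift[of r "n * p" "r + p" f, OF cont']
    by (simp add: o_def r_def add_diff_eq)
  also have "\<dots> = integral {r..r + p} f"
    by (simp add: n(2))
  also have "\<dots> = integral {r..p} f + integral {0 + p..r + p} f"
    using Henstock_Kurzweil_Integration.integral_combine[of r p "r + p" f] int n(1) by (simp add: r_def)
  also have "integral {0 + p..r + p} f = integral {0..r} f"
    using Henstock_Kurzweil_Integration.integral_shift[of 0 p r f, OF cont'] by (simp add: o_def per)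
  also have "integral {r..p} f + integral {0..r} f = integral {0..p} f"
    using Henstock_Kurzweil_Integration.integral_combine[of 0 r p f] int n(1) by (simp add: r_def add.commute)
  finally show ?thesis .
qed

text \<open>By compactness and periodicity the speed of \<open>c\<close> has a positive minimum and
  that of \<open>h\<close> a maximum, so for small \<open>t\<close> the second velocity cannot
  cancel the first. Openness of \<open>Imm\<close> along lines is what directional derivatives
  require.\<close>

lemma eventually_line_in_Imm:
  assumes c: "c \<in> Imm"
  shows "\<forall>\<^sub>F t in at 0. c + t *\<^sub>R h \<in> Imm"
proof -
  let ?c = "\<lambda>\<theta>. norm (vderiv (curve c) \<theta>)" and ?h = "\<lambda>\<theta>. norm (vderiv (curve h) \<theta>)"
  obtain \<theta>0 where min: "\<And>\<theta>. \<theta> \<in> {0..2 * pi} \<Longrightarrow> ?c \<theta>0 \<le> ?c \<theta>"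
    using continuous_attains_inf[of "{0..2 * pi}" ?c]
    by (metis compact_Icc atLeastatMost_empty_iff pi_ge_zero zero_le_mult_iff zero_le_numeral
        continuous_on_norm continuous_on_vderiv_curve)
  obtain \<theta>1 where max: "\<And>\<theta>. \<theta> \<in> {0..2 * pi} \<Longrightarrow> ?h \<theta> \<le> ?h \<theta>1"
    using continuous_attains_sup[of "{0..2 * pi}" ?h]
    by (metis compact_Icc atLeastatMost_empty_iff pi_ge_zero zero_le_mult_iff zero_le_numeral
        continuous_on_norm continuous_on_vderiv_curve)
  have min': "?c \<theta>0 \<le> ?c \<theta>" for \<theta>
  proof -
    obtain \<tau> where "\<tau> \<in> {0..2 * pi}" "vderiv (curve c) \<theta> = vderiv (curve c) \<tau>"
      using periodic_value_attained[of "2 * pi" "vderiv (curve c)" \<theta>]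
      by (auto simp: vderiv_curve_periodic)
    then show ?thesis
      using min by simp
  qed
  have max': "?h \<theta> \<le> ?h \<theta>1" for \<theta>
  proof -
    obtain \<tau> where "\<tau> \<in> {0..2 * pi}" "vderiv (curve h) \<theta> = vderiv (curve h) \<tau>"
      using periodic_value_attained[of "2 * pi" "vderiv (curve h)" \<theta>]
      by (auto simp: vderiv_curve_periodic)
    then show ?thesis
      using max by simp
  qed
  have "((\<lambda>t. \<bar>t\<bar> * ?h \<theta>1) \<longlongrightarrow> \<bar>0\<bar> * ?h \<theta>1) (at 0)"
    by (intro tendsto_intros)
  then have "\<forall>\<^sub>F t in at 0. \<bar>t\<bar> * ?h \<theta>1 < ?c \<theta>0"
    using c by (intro order_tendstoD(2)) (auto simp: Imm_def)
  then show ?thesis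
  proof (rule eventually_mono)
    fix t assume t: "\<bar>t\<bar> * ?h \<theta>1 < ?c \<theta>0"
    have "vderiv (curve (c + t *\<^sub>R h)) \<theta> \<noteq> 0" for \<theta>
    proof
      assume "vderiv (curve (c + t *\<^sub>R h)) \<theta> = 0"
      then have "vderiv (curve c) \<theta> = - (t *\<^sub>R vderiv (curve h) \<theta>)"
        by (simp add: vderiv_curve_line eq_neg_iff_add_eq_0)
      then have "?c \<theta> = \<bar>t\<bar> * ?h \<theta>"
        by simp
      also have "\<dots> \<le> \<bar>t\<bar> * ?h \<theta>1"
        by (simp add: max' mult_left_mono)
      finally show False
        using t min'[of \<theta>] by linarith
    qed
    then show "c + t *\<^sub>R h \<in> Imm"
      by (simp add: Imm_def)
  qed
qed


section \<open>Integral functionals on loops\<close>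

text \<open>The measure is that of the parameter, not of arclength: no base curve enters, and for
  continuous \<open>a\<close> the expression is bilinear in \<open>a\<close> and
  \<open>u\<close>.\<close>

definition pairing :: "(real \<Rightarrow> real^3) \<Rightarrow> loop \<Rightarrow> real" where
  "pairing a u = integral {0..2 * pi} (\<lambda>\<theta>. a \<theta> \<bullet> curve u \<theta>)"

lemma pairing_integrable:
  "continuous_on {0..2 * pi} a \<Longrightarrow> (\<lambda>\<theta>. a \<theta> \<bullet> curve u \<theta>) integrable_on {0..2 * pi}"
  by (intro integrable_continuous_interval continuous_intros)

lemma pairing_line_right:
  assumes "continuous_on {0..2 * pi} a"
  shows "pairing a (u + t *\<^sub>R v) = pairing a u + t * pairing a v"
proof -
  have "pairing a (u + t *\<^sub>R v)
      = integral {0..2 * pi} (\<lambda>\<theta>. a \<theta> \<bullet> curve u \<theta> + t * (a \<theta> \<bullet> curve v \<theta>))"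
    by (simp add: pairing_def curve_add curve_scaleR inner_add_right)
  then show ?thesis
    unfolding pairing_def
    by (simp add: integral_add[OF pairing_integrable[OF assms] integrable_on_mult_right[OF pairing_integrable[OF assms]]])
qed

lemma pairing_line_left:
  assumes "continuous_on {0..2 * pi} a" "continuous_on {0..2 * pi} b"
  shows "pairing (\<lambda>\<theta>. a \<theta> + t *\<^sub>R b \<theta>) u = pairing a u + t * pairing b u"
proof -
  have "pairing (\<lambda>\<theta>. a \<theta> + t *\<^sub>R b \<theta>) u
      = integral {0..2 * pi} (\<lambda>\<theta>. a \<theta> \<bullet> curve u \<theta> + t * (b \<theta> \<bullet> curve u \<theta>))"
    by (simp add: pairing_def inner_add_left)
  then show ?thesis
    unfolding pairing_def
    by (simp add: integral_add[OF pairing_integrable[OF assms(1)] integrable_on_mult_right[OF pairing_integrable[OF assms(2)]]])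
qed

section \<open>Convergence of loops and of their pairings\<close>

lemma open_sup_ball: "open {u. \<exists>d<e. \<forall>\<theta>. norm (curve u \<theta> - curve l \<theta>) \<le> d}"
  unfolding open_loop_def
proof safe
  fix u d assume d: "d < e" "\<forall>\<theta>. norm (curve u \<theta> - curve l \<theta>) \<le> d"
  have "\<exists>d<e. \<forall>\<theta>. norm (curve v \<theta> - curve l \<theta>) \<le> d"
    if v: "\<forall>j\<le>0. \<forall>\<theta>. norm (nth_vderiv j (curve (v - u)) \<theta>) < (e - d) / 2" for v
  \<comment> \<open>A bound \<open>d < e\<close> uniform in the parameter leaves the slack
    \<open>e - d\<close>; a perturbation uses up half of it, and the new bound is still below
    \<open>e\<close>.\<close>
  proof (intro exI[of _ "(e + d) / 2"] conjI allI)
    fix \<theta>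
    have "norm (curve v \<theta> - curve u \<theta>) < (e - d) / 2"
      using v by (simp add: curve_diff)
    then show "norm (curve v \<theta> - curve l \<theta>) \<le> (e + d) / 2"
      using d(2)[rule_format, of \<theta>] norm_triangle_ineq[of "curve v \<theta> - curve u \<theta>" "curve u \<theta> - curve l \<theta>"]
      by (simp add: field_simps)
  qed (use d in simp)
  then show "\<exists>n. \<exists>\<epsilon>>0. \<forall>g. (\<forall>j\<le>n. \<forall>\<theta>. norm (nth_vderiv j (curve (g - u)) \<theta>) < \<epsilon>) \<longrightarrow>
      g \<in> {u. \<exists>d<e. \<forall>\<theta>. norm (curve u \<theta> - curve l \<theta>) \<le> d}"
    using d(1) by (intro exI[of _ 0] exI[of _ "(e - d) / 2"]) auto
qed

text \<open>Links the loop topology to \<open>uniform_limit\<close>: the set in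
  \<open>open_sup_ball\<close> is an open neighbourhood of its centre.\<close>

lemma uniform_limit_curve:
  assumes "(F \<longlongrightarrow> l) G"
  shows "uniform_limit S (\<lambda>t. curve (F t)) (curve l) G"
proof (rule uniform_limitI)
  fix e :: real assume e: "e > 0"
  have "\<forall>\<^sub>F t in G. F t \<in> {u. \<exists>d<e. \<forall>\<theta>. norm (curve u \<theta> - curve l \<theta>) \<le> d}"
    by (intro topological_tendstoD[OF assms open_sup_ball]) (use e in auto)
  then show "\<forall>\<^sub>F t in G. \<forall>\<theta>\<in>S. dist (curve (F t) \<theta>) (curve l \<theta>) < e"
    by (rule eventually_mono) (auto simp: dist_norm intro: le_less_trans)
qed

text \<open>Uniform convergence survives multiplication by the bounded function \<open>a\<close> and
  allows limit and integral to be exchanged. The intended \<open>F\<close> is a difference quotient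
  of \<open>L\<close>, which converges in the loop topology.\<close>

lemma tendsto_pairing:
  assumes a: "continuous_on {0..2 * pi} a" and F: "(F \<longlongrightarrow> l) G" and G: "G \<noteq> bot"
  shows "((\<lambda>t. pairing a (F t)) \<longlongrightarrow> pairing a l) G"
proof -
  have bounded: "bounded (f ` {0..2 * pi})" if "continuous_on {0..2 * pi} f" for f :: "real \<Rightarrow> real^3"
    using that by (intro compact_imp_bounded compact_continuous_image) auto
  have lim: "uniform_limit {0..2 * pi} (\<lambda>t \<theta>. a \<theta> \<bullet> curve (F t) \<theta>) (\<lambda>\<theta>. a \<theta> \<bullet> curve l \<theta>) G"
    by (rule bounded_bilinear.bounded_uniform_limit[OF bounded_bilinear_inner uniform_limit_const
          uniform_limit_curve[OF F] bounded[OF continuous_on_curve] bounded[OF a]])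
  \<comment> \<open>\<open>uniform_limit_integral\<close> only supplies some values of the
    integrals; uniqueness identifies them with the pairings.\<close>
  obtain I J where IJ: "\<And>t. ((\<lambda>\<theta>. a \<theta> \<bullet> curve (F t) \<theta>) has_integral I t) {0..2 * pi}"
      "((\<lambda>\<theta>. a \<theta> \<bullet> curve l \<theta>) has_integral J) {0..2 * pi}" "(I \<longlongrightarrow> J) G"
    by (rule uniform_limit_integral[OF lim _ G]) (auto intro: continuous_intros a)
  then have "(\<lambda>t. pairing a (F t)) = I" "pairing a l = J"
    by (auto simp: pairing_def fun_eq_iff intro: integral_unique)
  with IJ(3) show ?thesis by simp
qed


section \<open>The derivative of \<open>\<Theta>\<close>\<close>

text \<open>This also holds at zeros of \<open>c\<^sub>\<theta>\<close>, where \<open>Ds\<close> takes the junk value 0.\<close>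

lemma norm_scaleR_Ds_self: "norm (vderiv (curve c) \<theta>) *\<^sub>R Ds c c \<theta> = vderiv (curve c) \<theta>"
  by (simp add: Ds_def)

lemma norm_scaleR_Ds:
  "c \<in> Imm \<Longrightarrow> norm (vderiv (curve c) \<theta>) *\<^sub>R Ds c h \<theta> = vderiv (curve h) \<theta>"
  by (simp add: Ds_def Imm_def)

text \<open>The arclength weight cancels even where the velocity vanishes, so this holds for every
  loop, and \<open>Theta\<close> can be expanded along a line that may leave
  \<open>Imm\<close>.\<close>

lemma Theta_eq_pairing:
  "Theta L c h = pairing (\<lambda>\<theta>. cross3 (curve c \<theta>) (vderiv (curve c) \<theta>)) (L c h)"
proof -
  have "(cross3 (curve c \<theta>) (Ds c c \<theta>) \<bullet> v) * norm (vderiv (curve c) \<theta>)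
      = cross3 (curve c \<theta>) (vderiv (curve c) \<theta>) \<bullet> v" for v \<theta>
    using arg_cong[OF norm_scaleR_Ds_self[of c \<theta>], of "\<lambda>x. cross3 (curve c \<theta>) x \<bullet> v"]
    by (simp add: cross_mult_right mult.commute)
  then show ?thesis
    by (simp add: Theta_def int_ds_def pairing_def)
qed

text \<open>The nested (Horner) form in \<open>t\<close> lets \<open>pairing_line_left\<close> be
  applied twice in a row.\<close>

lemma cross3_line:
  "cross3 (x + t *\<^sub>R y) (x' + t *\<^sub>R y')
    = cross3 x x' + t *\<^sub>R ((cross3 y x' + cross3 x y') + t *\<^sub>R cross3 y y')"
  by (simp add: cross_add_left cross_add_right cross_mult_left cross_mult_right algebra_simps)

text \<open>A product rule: one term differentiates the quadratic factor, the other the operator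
  \<open>L\<close>.\<close>

lemma dir_deriv_Theta:
  assumes diff: "dir_differentiable (\<lambda>x. L x k) c h"
  shows "dir_deriv (\<lambda>x. Theta L x k) c h
    = pairing (\<lambda>\<theta>. cross3 (curve h \<theta>) (vderiv (curve c) \<theta>)
                  + cross3 (curve c \<theta>) (vderiv (curve h) \<theta>)) (L c k)
    + pairing (\<lambda>\<theta>. cross3 (curve c \<theta>) (vderiv (curve c) \<theta>)) (dir_deriv (\<lambda>x. L x k) c h)"
proof -
  \<comment> \<open>\<open>A\<close>, \<open>B\<close> and \<open>C\<close> are the coefficients of
    1, \<open>t\<close> and \<open>t\<close> squared in the cross product along the line.\<close>
  define A where "A \<theta> = cross3 (curve c \<theta>) (vderiv (curve c) \<theta>)" for \<theta>
  define B where "B \<theta> = cross3 (curve h \<theta>) (vderiv (curve c) \<theta>)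
    + cross3 (curve c \<theta>) (vderiv (curve h) \<theta>)" for \<theta>
  define C where "C \<theta> = cross3 (curve h \<theta>) (vderiv (curve h) \<theta>)" for \<theta>
  have cont: "continuous_on S A" "continuous_on S B" "continuous_on S C" for S
    unfolding A_def B_def C_def by (intro continuous_intros continuous_on_cross)+
  define Q where "Q t = (1 / t) *\<^sub>R (L (c + t *\<^sub>R h) k - L c k)" for t
  define D where "D = dir_deriv (\<lambda>x. L x k) c h"
  \<comment> \<open>\<open>dir_deriv\<close> is a \<open>Lim\<close>, which is a genuine limit only
    because \<open>diff\<close> provides convergence.\<close>
  have Q: "(Q \<longlongrightarrow> D) (at 0)"
    using diff unfolding Q_def D_def dir_differentiable_def dir_deriv_def
    by (metis (mono_tags, lifting) tendsto_Lim trivial_limit_at)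
  \<comment> \<open>An exact identity, so no remainder has to be estimated. The value
    \<open>t = 0\<close> is excluded because there \<open>1 / t\<close> is 0.\<close>
  have quotient: "(1 / t) *\<^sub>R (Theta L (c + t *\<^sub>R h) k - Theta L c k)
      = pairing B (L c k) + t * pairing C (L c k)
        + (pairing A (Q t) + t * (pairing B (Q t) + t * pairing C (Q t)))"
    if t: "t \<noteq> 0" for t
  proof -
    have L: "L (c + t *\<^sub>R h) k = L c k + t *\<^sub>R Q t"
      using t by (simp add: Q_def)
    have "Theta L (c + t *\<^sub>R h) k = pairing (\<lambda>\<theta>. A \<theta> + t *\<^sub>R (B \<theta> + t *\<^sub>R C \<theta>)) (L c k + t *\<^sub>R Q t)"
      unfolding Theta_eq_pairing L vderiv_curve_line curve_add[of c] curve_scaleR[of t h] cross3_line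
      by (simp add: A_def B_def C_def)
    also have "\<dots> = pairing A (L c k) + t * (pairing B (L c k) + t * pairing C (L c k))
        + t * (pairing A (Q t) + t * (pairing B (Q t) + t * pairing C (Q t)))"
      by (subst pairing_line_right, (intro continuous_intros cont)[1],
          (subst pairing_line_left, (intro continuous_intros cont)[1],
            (intro continuous_intros cont)[1])+) simp
    finally show ?thesis
      using t by (simp add: Theta_eq_pairing[of L c k] A_def[symmetric] field_simps)
  qed
  \<comment> \<open>The vanishing terms are kept as multiples of 0 so that the limit has the shape
    produced by the limit rules.\<close>
  have lim: "((\<lambda>t. pairing B (L c k) + t * pairing C (L c k)
        + (pairing A (Q t) + t * (pairing B (Q t) + t * pairing C (Q t))))
      \<longlongrightarrow> pairing B (L c k) + 0 * pairing C (L c k)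
        + (pairing A D + 0 * (pairing B D + 0 * pairing C D))) (at 0)"
    by (intro tendsto_intros tendsto_pairing[OF cont(1) Q] tendsto_pairing[OF cont(2) Q]
        tendsto_pairing[OF cont(3) Q]) simp_all
  have "((\<lambda>t. (1 / t) *\<^sub>R (Theta L (c + t *\<^sub>R h) k - Theta L c k))
      \<longlongrightarrow> pairing B (L c k) + pairing A D) (at 0)"
    using Lim_transform_eventually[OF lim] quotient
    by (simp add: eventually_at_filter)
  then have "dir_deriv (\<lambda>x. Theta L x k) c h = pairing B (L c k) + pairing A D"
    unfolding dir_deriv_def by (intro tendsto_Lim) simp
  then show ?thesis
    unfolding A_def B_def D_def .
qed

section \<open>From the derivative of \<open>Theta\<close> to the formula for
  \<open>Omega\<close>\<close>

lemma dir_deriv_const: "dir_deriv (\<lambda>_. k) c h = 0"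
  by (simp add: dir_deriv_def tendsto_Lim)

lemma inertia_operator_linear: "inertia_operator L \<Longrightarrow> c \<in> Imm \<Longrightarrow> linear (L c)"
  by (simp add: inertia_operator_def)

lemma inertia_operator_dir_differentiable:
  assumes "inertia_operator L" "c \<in> Imm"
  shows "dir_differentiable (\<lambda>x. L x k) c h"
proof -
  have "frechet_smooth_on (Imm \<times> UNIV) (\<lambda>(c, h). L c h)"
    using assms(1) by (simp add: inertia_operator_def)
  \<comment> \<open>Smoothness is given on the total space; the direction \<open>(h, 0)\<close>
    moves the base point and keeps \<open>k\<close> fixed.\<close>
  then have "dir_differentiable (iter_deriv (\<lambda>(c, h). L c h) []) (c, k) (h, 0)"
    using assms(2) unfolding frechet_smooth_on_def by blast
  then show ?thesis
    by (simp add: dir_differentiable_def)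
qed

lemma Theta_zero: "linear (L c) \<Longrightarrow> Theta L c 0 = 0"
  by (simp add: Theta_eq_pairing pairing_def linear_0 curve_zero)

text \<open>Constant fields have zero bracket, and \<open>Theta\<close> vanishes on it by linearity
  of \<open>L c\<close>. The minus sign in \<open>Omega\<close> swaps the two derivatives.\<close>

lemma Omega_eq_dir_deriv:
  assumes "linear (L c)"
  shows "Omega L c h k = dir_deriv (\<lambda>x. Theta L x h) c k - dir_deriv (\<lambda>x. Theta L x k) c h"
  by (simp add: Omega_def ext_deriv_def lie_bracket_def dir_deriv_const Theta_zero[of L c, OF assms])

text \<open>Every summand contains exactly one \<open>Ds\<close>, which absorbs the arclength
  weight. The integrands then agree pointwise, without integration by parts.\<close>

lemma Omega_formula:
  assumes L: "inertia_operator L" and c: "c \<in> Imm"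
  shows "Omega L c h k = int_ds c (\<lambda>\<theta>.
            Ds c c \<theta> \<bullet> (cross3 (curve (L c h) \<theta>) (curve k \<theta>) + cross3 (curve h \<theta>) (curve (L c k) \<theta>))
          - curve c \<theta> \<bullet> (cross3 (Ds c h \<theta>) (curve (L c k) \<theta>) + cross3 (curve (L c h) \<theta>) (Ds c k \<theta>))
          + cross3 (curve c \<theta>) (Ds c c \<theta>) \<bullet>
              (curve (dir_deriv (\<lambda>x. L x h) c k) \<theta> - curve (dir_deriv (\<lambda>x. L x k) c h) \<theta>))"
    (is "_ = int_ds c ?f")
proof -
  let ?B = "\<lambda>h \<theta>. cross3 (curve h \<theta>) (vderiv (curve c) \<theta>) + cross3 (curve c \<theta>) (vderiv (curve h) \<theta>)"
  let ?A = "\<lambda>\<theta>. cross3 (curve c \<theta>) (vderiv (curve c) \<theta>)"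
  let ?D = "\<lambda>h k. dir_deriv (\<lambda>x. L x k) c h"
  have int: "(\<lambda>\<theta>. ?B h \<theta> \<bullet> curve u \<theta>) integrable_on {0..2 * pi}"
    "(\<lambda>\<theta>. ?A \<theta> \<bullet> curve u \<theta>) integrable_on {0..2 * pi}" for h u
    by (intro pairing_integrable continuous_intros continuous_on_cross)+
  have "Omega L c h k = (pairing (?B k) (L c h) + pairing ?A (?D k h))
      - (pairing (?B h) (L c k) + pairing ?A (?D h k))"
    by (simp add: Omega_eq_dir_deriv inertia_operator_linear[OF L c] dir_deriv_Theta
        inertia_operator_dir_differentiable[OF L c])
  also have "\<dots> = integral {0..2 * pi} (\<lambda>\<theta>.
      (?B k \<theta> \<bullet> curve (L c h) \<theta> + ?A \<theta> \<bullet> curve (?D k h) \<theta>)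
      - (?B h \<theta> \<bullet> curve (L c k) \<theta> + ?A \<theta> \<bullet> curve (?D h k) \<theta>))"
    unfolding pairing_def
    by (simp only: integral_add[OF int(1) int(2)] integral_diff integrable_add[OF int(1) int(2)])
  also have "\<dots> = int_ds c ?f"
    unfolding int_ds_def
  proof (rule integral_cong)
    fix \<theta>
    let ?n = "norm (vderiv (curve c) \<theta>)"
    \<comment> \<open>Pure vector algebra, by the cyclic symmetry and antisymmetry of the scalar
      triple product; primed letters stand for the derivatives in the parameter.\<close>
    have triple: "(cross3 k c' + cross3 x k') \<bullet> Lh + cross3 x c' \<bullet> Dk
        - ((cross3 h c' + cross3 x h') \<bullet> Lk + cross3 x c' \<bullet> Dh)
        = c' \<bullet> (cross3 Lh k + cross3 h Lk) - x \<bullet> (cross3 h' Lk + cross3 Lh k')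
          + cross3 x c' \<bullet> (Dk - Dh)" for x c' h k h' k' Lh Lk Dh Dk :: "real^3"
      by (simp add: cross3_simps)
    have "?f \<theta> * ?n =
        (?n *\<^sub>R Ds c c \<theta>) \<bullet> (cross3 (curve (L c h) \<theta>) (curve k \<theta>) + cross3 (curve h \<theta>) (curve (L c k) \<theta>))
          - curve c \<theta> \<bullet> (cross3 (?n *\<^sub>R Ds c h \<theta>) (curve (L c k) \<theta>)
              + cross3 (curve (L c h) \<theta>) (?n *\<^sub>R Ds c k \<theta>))
          + cross3 (curve c \<theta>) (?n *\<^sub>R Ds c c \<theta>) \<bullet> (curve (?D k h) \<theta> - curve (?D h k) \<theta>)"
      by (simp add: cross_mult_left cross_mult_right inner_add_right algebra_simps)
    then show "(?B k \<theta> \<bullet> curve (L c h) \<theta> + ?A \<theta> \<bullet> curve (?D k h) \<theta>)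
      - (?B h \<theta> \<bullet> curve (L c k) \<theta> + ?A \<theta> \<bullet> curve (?D h k) \<theta>) = ?f \<theta> * ?n"
      unfolding norm_scaleR_Ds[OF c] triple by simp
  qed
  finally show ?thesis .
qed


section \<open>Invariance\<close>

text \<open>\<open>Lim\<close> is a description of the limit, so having the same limits for each
  \<open>l\<close> forces equality, whether or not a limit exists.\<close>

lemma dir_deriv_eventually_cong:
  assumes "\<forall>\<^sub>F t in at 0. F (x + t *\<^sub>R h) = F' (x' + t *\<^sub>R h')" and "F x = F' x'"
  shows "dir_deriv F x h = dir_deriv F' x' h'"
proof -
  have "((\<lambda>t. (1 / t) *\<^sub>R (F (x + t *\<^sub>R h) - F x)) \<longlongrightarrow> l) (at 0)
      \<longleftrightarrow> ((\<lambda>t. (1 / t) *\<^sub>R (F' (x' + t *\<^sub>R h') - F' x')) \<longlongrightarrow> l) (at 0)" for l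
    using assms by (intro filterlim_cong) (auto elim: eventually_mono)
  then show ?thesis
    by (simp add: dir_deriv_def Topological_Spaces.Lim_def)
qed

text \<open>Treats both groups at once: a linear \<open>T\<close> sends the line through
  \<open>c\<close> along \<open>h\<close> to the line through \<open>T c\<close> along
  \<open>T h\<close>, so both difference quotients of \<open>Theta\<close> agree.\<close>

lemma Omega_invariant_under_linear:
  assumes L: "\<And>c. c \<in> Imm \<Longrightarrow> linear (L c)" and T: "linear T"
    and Imm: "\<And>c. c \<in> Imm \<Longrightarrow> T c \<in> Imm"
    and Theta: "\<And>c h. c \<in> Imm \<Longrightarrow> Theta L (T c) (T h) = Theta L c h"
    and c: "c \<in> Imm"
  shows "Omega L (T c) (T h) (T k) = Omega L c h k"
proof -
  have "dir_deriv (\<lambda>x. Theta L x (T k)) (T c) (T h) = dir_deriv (\<lambda>x. Theta L x k) c h" for h k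
  proof (rule dir_deriv_eventually_cong)
    show "\<forall>\<^sub>F t in at 0. Theta L (T c + t *\<^sub>R T h) (T k) = Theta L (c + t *\<^sub>R h) k"
      \<comment> \<open>Invariance of \<open>Theta\<close> is available at immersions only, hence
        the restriction to small \<open>t\<close>.\<close>
      using eventually_line_in_Imm[OF c]
    proof (rule eventually_mono)
      fix t assume "c + t *\<^sub>R h \<in> Imm"
      then show "Theta L (T c + t *\<^sub>R T h) (T k) = Theta L (c + t *\<^sub>R h) k"
        using Theta[of "c + t *\<^sub>R h" k] by (simp add: linear_add[OF T] linear_scale[OF T])
    qed
  qed (rule Theta[OF c])
  then show ?thesis
    by (simp add: Omega_eq_dir_deriv L Imm c)
qed

lemma loop_eqI: "(\<And>\<theta>. curve c \<theta> = curve h \<theta>) \<Longrightarrow> c = h"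
  by (metis curve_inject ext)

section \<open>Reparametrizations\<close>

lemma linear_reparam: "\<phi> \<in> Diff_plus \<Longrightarrow> linear (\<lambda>c. reparam c \<phi>)"
  by (intro linearI loop_eqI) (simp_all add: curve_reparam curve_add curve_scaleR)

lemma Diff_plus_has_vderiv:
  "\<phi> \<in> Diff_plus \<Longrightarrow> (\<phi> has_vector_derivative vderiv \<phi> \<theta>) (at \<theta>)"
  by (simp add: Diff_plus_def smooth_has_vderiv)

lemma vderiv_curve_reparam:
  assumes "\<phi> \<in> Diff_plus"
  shows "vderiv (curve (reparam c \<phi>)) \<theta> = vderiv \<phi> \<theta> *\<^sub>R vderiv (curve c) (\<phi> \<theta>)"
proof -
  have "curve (reparam c \<phi>) = curve c \<circ> \<phi>"
    using curve_reparam[OF assms] by (simp add: fun_eq_iff)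
  then show ?thesis
    using vector_diff_chain_at[OF Diff_plus_has_vderiv[OF assms] curve_has_vderiv]
    by (simp add: vderiv_def vector_derivative_at)
qed

lemma reparam_in_Imm:
  assumes "\<phi> \<in> Diff_plus" "c \<in> Imm"
  shows "reparam c \<phi> \<in> Imm"
proof -
  have "vderiv \<phi> \<theta> > 0" for \<theta>
    using assms(1) by (simp add: Diff_plus_def)
  then have "vderiv \<phi> \<theta> \<noteq> 0" for \<theta>
    by (metis less_irrefl)
  then show ?thesis
    using assms(2) by (simp add: Imm_def vderiv_curve_reparam[OF assms(1)])
qed

text \<open>Substitution turns the period \<open>{0..2 * pi}\<close> into one starting at
  \<open>\<phi> 0\<close>; \<open>integral_periodic\<close> moves it back.\<close>

lemma integral_Diff_plus:
  fixes g :: "real \<Rightarrow> real"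
  assumes \<phi>: "\<phi> \<in> Diff_plus" and per: "\<And>x. g (x + 2 * pi) = g x" and cont: "continuous_on UNIV g"
  shows "integral {0..2 * pi} (\<lambda>\<theta>. vderiv \<phi> \<theta> * g (\<phi> \<theta>)) = integral {0..2 * pi} g"
proof -
  have deriv: "(\<phi> has_field_derivative vderiv \<phi> x) (at x)" for x
    using Diff_plus_has_vderiv[OF \<phi>] by (simp add: has_real_derivative_iff_has_vector_derivative)
  have mono: "\<phi> x \<le> \<phi> y" if "x \<le> y" for x y
    using deriv \<phi> unfolding Diff_plus_def
    by (intro DERIV_nonneg_imp_nondecreasing[OF that]) (blast intro: less_imp_le)
  have end_eq: "\<phi> (2 * pi) = \<phi> 0 + 2 * pi"
    using \<phi> by (auto simp: Diff_plus_def dest: spec[of _ 0])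
  have "((\<lambda>x. vderiv \<phi> x *\<^sub>R g (\<phi> x)) has_integral integral {\<phi> 0..\<phi> (2 * pi)} g) {0..2 * pi}"
    by (rule has_integral_substitution[where c = "\<phi> 0" and d = "\<phi> (2 * pi)"])
      (auto intro: mono continuous_on_subset[OF cont] has_field_derivative_at_within deriv)
  then show ?thesis
    using integral_periodic[of "2 * pi" g "\<phi> 0"] per cont
    by (simp add: end_eq integral_unique)
qed

text \<open>Only the velocity of \<open>c\<close> yields a factor \<open>vderiv \<phi>\<close> under
  the chain rule, and this single factor is the Jacobian of the substitution.\<close>

lemma Theta_reparam:
  assumes "Diff_equivariant L" and \<phi>: "\<phi> \<in> Diff_plus" and "c \<in> Imm"
  shows "Theta L (reparam c \<phi>) (reparam h \<phi>) = Theta L c h"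
proof -
  have L: "L (reparam c \<phi>) (reparam h \<phi>) = reparam (L c h) \<phi>"
    using assms unfolding Diff_equivariant_def by blast
  let ?g = "\<lambda>\<theta>. cross3 (curve c \<theta>) (vderiv (curve c) \<theta>) \<bullet> curve (L c h) \<theta>"
  have "Theta L (reparam c \<phi>) (reparam h \<phi>) = integral {0..2 * pi} (\<lambda>\<theta>. vderiv \<phi> \<theta> * ?g (\<phi> \<theta>))"
    by (simp add: Theta_eq_pairing pairing_def L curve_reparam[OF \<phi>] vderiv_curve_reparam[OF \<phi>]
        cross_mult_right)
  also have "\<dots> = integral {0..2 * pi} ?g"
    by (intro integral_Diff_plus[OF \<phi>] continuous_intros continuous_on_cross)
      (simp add: curve_periodic vderiv_curve_periodic)
  finally show ?thesis
    by (simp add: Theta_eq_pairing pairing_def)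
qed

section \<open>Rotations\<close>

lemma curve_rotate_loop: "curve (rotate_loop A c) \<theta> = A *v curve c \<theta>"
  by (simp add: rotate_loop.rep_eq)

lemma linear_rotate_loop: "linear (rotate_loop A)"
  by (intro linearI loop_eqI)
    (simp_all add: curve_rotate_loop curve_add curve_scaleR matrix_vector_right_distrib
      matrix_vector_mult_scaleR)

lemma vderiv_curve_rotate_loop: "vderiv (curve (rotate_loop A c)) \<theta> = A *v vderiv (curve c) \<theta>"
proof -
  have "curve (rotate_loop A c) = (\<lambda>\<theta>. A *v curve c \<theta>)"
    by (simp add: fun_eq_iff curve_rotate_loop)
  then show ?thesis
    using vderiv_eqI[of "\<lambda>\<theta>. A *v curve c \<theta>" "\<lambda>\<theta>. A *v vderiv (curve c) \<theta>"]
      bounded_linear.has_vector_derivative[OF matrix_vector_mul_bounded_linear curve_has_vderiv]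
    by metis
qed

lemma rotation_matrix_inner:
  fixes A :: "real^3^3"
  assumes "rotation_matrix A"
  shows "(A *v x) \<bullet> (A *v y) = x \<bullet> y"
proof -
  have "orthogonal_transformation ((*v) A)"
    using assms by (simp add: rotation_matrix_def orthogonal_transformation_matrix)
  then show ?thesis
    by (simp add: orthogonal_transformation_def)
qed

lemma rotate_loop_in_Imm:
  assumes "rotation_matrix A" "c \<in> Imm"
  shows "rotate_loop A c \<in> Imm"
proof -
  have "A *v x \<noteq> 0" if "x \<noteq> 0" for x
    using rotation_matrix_inner[OF assms(1), of x x] that by auto
  then show ?thesis
    using assms(2) by (simp add: Imm_def vderiv_curve_rotate_loop)
qed

text \<open>Rotations commute with the cross product, where determinant 1 matters since a reflection
  would flip the sign, and they preserve the inner product.\<close>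

lemma Theta_rotate_loop:
  assumes "SO3_equivariant L" and A: "rotation_matrix A" and "c \<in> Imm"
  shows "Theta L (rotate_loop A c) (rotate_loop A h) = Theta L c h"
proof -
  have "L (rotate_loop A c) (rotate_loop A h) = rotate_loop A (L c h)"
    using assms unfolding SO3_equivariant_def by blast
  then show ?thesis
    by (simp add: Theta_eq_pairing pairing_def curve_rotate_loop vderiv_curve_rotate_loop
        cross_rotation_matrix[OF A] rotation_matrix_inner[OF A])
qed

theorem theorem2p4:
  fixes L :: "loop \<Rightarrow> loop \<Rightarrow> loop"
  assumes "inertia_operator L"
    and "Diff_equivariant L"
    and "SO3_equivariant L"
  shows "(\<forall>c\<in>Imm. \<forall>h k. Omega L c h k = int_ds c (\<lambda>\<theta>.
            Ds c c \<theta> \<bullet> (cross3 (curve (L c h) \<theta>) (curve k \<theta>) + cross3 (curve h \<theta>) (curve (L c k) \<theta>))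
          - curve c \<theta> \<bullet> (cross3 (Ds c h \<theta>) (curve (L c k) \<theta>) + cross3 (curve (L c h) \<theta>) (Ds c k \<theta>))
          + cross3 (curve c \<theta>) (Ds c c \<theta>) \<bullet>
              (curve (dir_deriv (\<lambda>x. L x h) c k) \<theta> - curve (dir_deriv (\<lambda>x. L x k) c h) \<theta>)))
    \<and> (\<forall>c\<in>Imm. \<forall>h k. \<forall>\<phi>\<in>Diff_plus.
          Omega L (reparam c \<phi>) (reparam h \<phi>) (reparam k \<phi>) = Omega L c h k)
    \<and> (\<forall>c\<in>Imm. \<forall>h k A. rotation_matrix A \<longrightarrow>
          Omega L (rotate_loop A c) (rotate_loop A h) (rotate_loop A k) = Omega L c h k)"
proof (intro conjI ballI allI impI)
  note linear = inertia_operator_linear[OF assms(1)]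
  fix c h k assume c: "c \<in> Imm"
  show "Omega L c h k = int_ds c (\<lambda>\<theta>.
            Ds c c \<theta> \<bullet> (cross3 (curve (L c h) \<theta>) (curve k \<theta>) + cross3 (curve h \<theta>) (curve (L c k) \<theta>))
          - curve c \<theta> \<bullet> (cross3 (Ds c h \<theta>) (curve (L c k) \<theta>) + cross3 (curve (L c h) \<theta>) (Ds c k \<theta>))
          + cross3 (curve c \<theta>) (Ds c c \<theta>) \<bullet>
              (curve (dir_deriv (\<lambda>x. L x h) c k) \<theta> - curve (dir_deriv (\<lambda>x. L x k) c h) \<theta>))"
    by (rule Omega_formula[OF assms(1) c])
  show "Omega L (reparam c \<phi>) (reparam h \<phi>) (reparam k \<phi>) = Omega L c h k"
    if "\<phi> \<in> Diff_plus" for \<phi>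
    by (rule Omega_invariant_under_linear[of L "\<lambda>c. reparam c \<phi>"])
      (use that c linear assms(2) in \<open>auto intro: linear_reparam reparam_in_Imm Theta_reparam\<close>)
  show "Omega L (rotate_loop A c) (rotate_loop A h) (rotate_loop A k) = Omega L c h k"
    if "rotation_matrix A" for A
    by (rule Omega_invariant_under_linear[of L "rotate_loop A"])
      (use that c linear assms(3) in \<open>auto intro: linear_rotate_loop rotate_loop_in_Imm Theta_rotate_loop\<close>)
qed

end
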